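(* Let $T\in\mathbb{R}_+^*$, $L,M\in\mathbb{N}$, let $0\le\alpha_0<\alpha_1<\cdots<\alpha_L$ and $0\le\beta_0<\beta_1<\cdots<\beta_M$ be real numbers, put $\alpha=\max(\alpha_L,\beta_M)$ and $l=\lceil\alpha\rceil\in\mathbb{N}^*$, let $N\in\mathbb{N}$ with $N\ge L+M+1$, and let $\{g_n\}_{n=1}^N$ be modulating functions of order $l$ on $[0,T]$. Assume that the noise is $\varpi(t)=c\sin(\omega t+\phi)$ for all $t\in[0,T]$, with $c,\omega\in\mathbb{R}_+^*$ and $\phi\in[0,2\pi)$. Assume moreover that $\mathrm{D}_t^{\alpha_i+1}g_n(t)$ exists and is continuous on $[0,T]$ for $n=1,\dots,N$ and $i=0,\dots,L$. Then the noise error contribution $$e_N^{\varpi}(n,i+1)=\int_0^T\mathrm{D}_t^{\alpha_i}g_n(t)\,\varpi(T-t)\,dt$$ satisfies, for all $n=1,\dots,N$ and $i=0,\dots,L$, $$\left|e_N^{\varpi}(n,i+1)\right|\le\frac{c}{\omega}\,T\,C_{\alpha_i+1}+\frac{c}{\omega}\left|\left[\mathrm{D}_t^{\alpha_i}g_n(t)\right]_{t=T}\right|,$$ where $C_{\alpha_i+1}=\sup_{t\in[0,T]}\left|\mathrm{D}_t^{\alpha_i+1}g_n(t)\right|$.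
   Context: $\mathbb{R}_+^*=(0,\infty)$, $\mathbb{N}^*=\{1,2,\dots\}$; $\lceil\alpha\rceil$ is the smallest integer greater than or equal to $\alpha$. Riemann-Liouville fractional derivative (with base point $0$): for a continuous function $f$ and $\gamma\ge 0$ with $k-1\le\gamma<k$, $k\in\mathbb{N}^*$, for $t>0$, $$\mathrm{D}_t^{\gamma}f(t):=\frac{1}{\Gamma(k-\gamma)}\frac{d^k}{dt^k}\int_0^t (t-\tau)^{k-\gamma-1}f(\tau)\,d\tau .$$ For integer $\gamma$ this is the usual derivative of order $\gamma$. For a function given only on $[0,T]$ the formula is used for $t\in(0,T]$, with the derivative at $t=T$ taken from the left; the value at $t=0$ is the limit as $t\to0^+$. Modulating function of order $l$ ($l\in\mathbb{N}^*$) on $[0,T]$: a function $g\in\mathcal{C}^l([0,T])$ such that $g^{(j)}(0)=g^{(j)}(T)=0$ for all $j=0,1,\dots,l-1$. The notation $[\,h(t)\,]_{t=T}$ denotes the value of $h$ at $t=T$. *)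

theory Defs
  imports "HOL-Analysis.Analysis"
begin

text \<open>Iterated derivatives relative to a set \<open>S\<close>; at endpoints of an interval that belong to \<open>S\<close>
  they are one-sided. The value is meaningful only together with \<open>times_differentiable_on\<close>.\<close>

primrec deriv_within :: "nat \<Rightarrow> real set \<Rightarrow> (real \<Rightarrow> real) \<Rightarrow> real \<Rightarrow> real" where
  "deriv_within 0 S f = f"
| "deriv_within (Suc k) S f = (\<lambda>t. vector_derivative (deriv_within k S f) (at t within S))"

definition times_differentiable_on :: "nat \<Rightarrow> (real \<Rightarrow> real) \<Rightarrow> real set \<Rightarrow> bool" where
  "times_differentiable_on k f S \<longleftrightarrow> (\<forall>j<k. deriv_within j S f differentiable_on S)"

definition Ck_on :: "nat \<Rightarrow> (real \<Rightarrow> real) \<Rightarrow> real set \<Rightarrow> bool" where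
  "Ck_on k f S \<longleftrightarrow> times_differentiable_on k f S \<and> continuous_on S (deriv_within k S f)"

definition modulating_function :: "nat \<Rightarrow> real \<Rightarrow> (real \<Rightarrow> real) \<Rightarrow> bool" where
  "modulating_function l T g \<longleftrightarrow>
     l \<ge> 1 \<and> Ck_on l g {0..T} \<and>
     (\<forall>j<l. deriv_within j {0..T} g 0 = 0 \<and> deriv_within j {0..T} g T = 0)"

text \<open>The order \<open>k\<close> with \<open>k - 1 \<le> \<gamma> < k\<close>, for \<open>\<gamma> \<ge> 0\<close>.\<close>

definition rl_order :: "real \<Rightarrow> nat" where
  "rl_order \<gamma> = nat \<lfloor>\<gamma>\<rfloor> + 1"

text \<open>For integer \<open>\<gamma>\<close> the kernel is \<open>(t - \<tau>) powr 0\<close>, which is \<open>1\<close> except at the single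
  point \<open>\<tau> = t\<close>, where it is \<open>0\<close>; this does not affect the integral.\<close>

definition rl_integral :: "real \<Rightarrow> (real \<Rightarrow> real) \<Rightarrow> real \<Rightarrow> real" where
  "rl_integral \<gamma> f t =
     integral {0..t} (\<lambda>\<tau>. (t - \<tau>) powr (real (rl_order \<gamma>) - \<gamma> - 1) * f \<tau>)"

definition rl_deriv_pos :: "real \<Rightarrow> real \<Rightarrow> (real \<Rightarrow> real) \<Rightarrow> real \<Rightarrow> real" where
  "rl_deriv_pos T \<gamma> f t =
     1 / Gamma (real (rl_order \<gamma>) - \<gamma>) *
       deriv_within (rl_order \<gamma>) {0<..T} (rl_integral \<gamma> f) t"

text \<open>The Riemann-Liouville derivative with base point \<open>0\<close> of a function on \<open>[0,T]\<close>: the defining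
  formula on \<open>(0,T]\<close> (left derivatives at \<open>T\<close>), and the limit from the right at \<open>0\<close>.\<close>

definition rl_deriv :: "real \<Rightarrow> real \<Rightarrow> (real \<Rightarrow> real) \<Rightarrow> real \<Rightarrow> real" where
  "rl_deriv T \<gamma> f t =
     (if t = 0 then Lim (at_right 0) (rl_deriv_pos T \<gamma> f) else rl_deriv_pos T \<gamma> f t)"

definition rl_deriv_exists :: "real \<Rightarrow> real \<Rightarrow> (real \<Rightarrow> real) \<Rightarrow> bool" where
  "rl_deriv_exists T \<gamma> f \<longleftrightarrow>
     times_differentiable_on (rl_order \<gamma>) (rl_integral \<gamma> f) {0<..T} \<and>
     (\<exists>v. (rl_deriv_pos T \<gamma> f \<longlongrightarrow> v) (at_right 0))"

definition noise_error :: "real \<Rightarrow> real \<Rightarrow> (real \<Rightarrow> real) \<Rightarrow> (real \<Rightarrow> real) \<Rightarrow> real" where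
  "noise_error T \<gamma> g w = integral {0..T} (\<lambda>t. rl_deriv T \<gamma> g t * w (T - t))"

end

theory Submission
  imports Defs
begin

text \<open>
  Let \<open>G\<close> be the derivative of order \<open>\<gamma>\<close> of a modulating function \<open>g\<close>, so that \<open>G'\<close> is the one of
  order \<open>\<gamma> + 1\<close>. If \<open>\<gamma> < l\<close>, then \<open>G 0 = 0\<close>: near \<open>0\<close> the fractional integral is \<open>o (t ^ k)\<close>, where
  \<open>k\<close> is the number of derivatives taken, while all these derivatives have limits at \<open>0\<close>. Integration
  by parts against the sine then gives the bound.

  If \<open>\<gamma> = l\<close>, the boundary term at \<open>0\<close> survives, but \<open>G\<close> has mean zero, being the derivative of a
  function that vanishes at both ends. After rescaling and reversing time to \<open>K\<close> on \<open>[0,1]\<close>, with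
  \<open>\<theta> = \<omega> T\<close>, the mean zero condition is used in two ways. For \<open>\<theta> \<le> 4\<close>, the \<open>L\<^sup>2\<close> norm of \<open>K\<close> is at most
  \<open>B / sqrt 12\<close> for a bound \<open>B\<close> of the derivative, and the Cauchy-Schwarz inequality suffices without
  integration by parts. For \<open>\<theta> \<ge> 4\<close>, the unwanted boundary term is an integral against \<open>K'\<close>, which
  reduces the claim to an \<open>L\<^sup>2\<close> estimate for a cosine minus a linear function.
\<close>

subsection \<open>The distance between a cosine and a chord\<close>

lemma quadratic_form_nonneg:
  fixes p q r A S :: real
  assumes "q\<^sup>2 \<le> p * r" "r > 0"
  shows "0 \<le> p * A\<^sup>2 + 2 * q * A * S + r * S\<^sup>2"
proof -
  have "r * (p * A\<^sup>2 + 2 * q * A * S + r * S\<^sup>2) = (r * S + q * A)\<^sup>2 + (p * r - q\<^sup>2) * A\<^sup>2"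
    by (simp add: power2_eq_square algebra_simps)
  also have "\<dots> \<ge> 0" using assms by simp
  finally show ?thesis using \<open>r > 0\<close> by (simp add: zero_le_mult_iff)
qed

text \<open>With \<open>x = 1 / \<theta>\<close>, \<open>c = cos \<theta>\<close>, \<open>s = sin \<theta>\<close> this is the discriminant condition for the quadratic form in
  the sine and cosine of \<open>\<theta> + \<phi>\<close> that arises in \<open>cos_minus_chord_L2\<close>.\<close>

lemma discriminant_estimate:
  fixes c s x :: real
  assumes cs: "c\<^sup>2 + s\<^sup>2 = 1" and x: "0 \<le> x" "x \<le> 1/4"
  shows "((1 + c\<^sup>2) * x / 2 - s * x\<^sup>2)\<^sup>2
           \<le> (1/6 - s * c * x / 2 + 2 * (1 - c) * x\<^sup>2) * (1/2 + s * c * x / 2)"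
    and "1/2 + s * c * x / 2 > 0"
proof -
  have "\<bar>s * c\<bar> \<le> 1/2"
    using cs sum_squares_bound[of c s] sum_squares_bound[of c "-s"]
    by (simp add: abs_le_iff algebra_simps)
  then have "\<bar>s * c\<bar> * x \<le> 1/2 * (1/4)" using x by (intro mult_mono) auto
  then have a: "\<bar>s * c * x\<bar> \<le> 1/8" using x by (simp add: abs_mult)
  then show "1/2 + s * c * x / 2 > 0" by (auto simp: abs_if split: if_splits)
  have s1: "s\<^sup>2 \<le> 1" and "c\<^sup>2 \<le> 1"
    using cs zero_le_power2[of c] zero_le_power2[of s] by linarith+
  then have c1: "\<bar>c\<bar> \<le> 1" by (simp add: abs_square_le_1)
  have x2: "x\<^sup>2 \<le> 1/16" using power_mono[OF x(2,1), of 2] by (simp add: power2_eq_square)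
  define y where "y = \<bar>s\<bar> * x"
  define m where "m = - c / 6 + (2 - s\<^sup>2) * x\<^sup>2"
  \<comment> \<open>In the last product of the right-hand side the factor 1/2 is split as 7/16 +
    1/16. The 1/16 part is nonnegative together with \<open>s * c * x / 2\<close>, because
    \<open>\<bar>s * c * x\<bar> \<le> 1/8\<close>; everything else is collected in
    \<open>R\<close>.\<close>
  define R where "R = 1/12 - x\<^sup>2 + 7/8 * (1 - c) * x\<^sup>2 + s\<^sup>2 * x\<^sup>2 * (3/4 - x\<^sup>2) + s * x * m"
  have "(1/6 - s * c * x / 2 + 2 * (1 - c) * x\<^sup>2) * (1/2 + s * c * x / 2)
          - ((1 + c\<^sup>2) * x / 2 - s * x\<^sup>2)\<^sup>2
        = R + 2 * (1 - c) * x\<^sup>2 * (1/16 + s * c * x / 2)"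
  proof -
    have "(s * c * x / 2)\<^sup>2 = s\<^sup>2 * c\<^sup>2 * x\<^sup>2 / 4"
      by (simp add: power_mult_distrib power_divide)
    moreover have c2: "c\<^sup>2 = 1 - s\<^sup>2" using cs by simp
    ultimately have a2: "(s * c * x / 2)\<^sup>2 = s\<^sup>2 * (1 - s\<^sup>2) * x\<^sup>2 / 4" by simp
    have e: "(1/6 - s * c * x / 2 + 2 * (1 - c) * x\<^sup>2) * (1/2 + s * c * x / 2)
        = 1/12 - s * c * x / 6 - (s * c * x / 2)\<^sup>2 + 2 * (1 - c) * x\<^sup>2 * (1/2 + s * c * x / 2)"
      by (simp add: power2_eq_square field_simps)
    show ?thesis unfolding e R_def m_def a2 c2
      by (simp add: power2_eq_square field_simps)
  qed
  moreover have "2 * (1 - c) * x\<^sup>2 * (1/16 + s * c * x / 2) \<ge> 0"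
    using a c1 by (intro mult_nonneg_nonneg) (auto simp: abs_if split: if_splits)
  moreover have "R \<ge> 0"
  proof -
    have m_bound: "0 \<le> (2 - s\<^sup>2) * x\<^sup>2" "(2 - s\<^sup>2) * x\<^sup>2 \<le> 1/8"
      using s1 x2 mult_mono[of "2 - s\<^sup>2" 2 "x\<^sup>2" "1/16"] by auto
    have y: "s\<^sup>2 * x\<^sup>2 = y\<^sup>2" by (simp add: y_def power_mult_distrib)
    have y0: "y \<ge> 0" using x by (simp add: y_def)
    have q: "s\<^sup>2 * x\<^sup>2 * (3/4 - x\<^sup>2) \<ge> y\<^sup>2 * (11/16)"
      unfolding y by (rule mult_left_mono) (use x2 in auto)
    have sm: "s * x * m \<ge> - (y * \<bar>m\<bar>)"
      using abs_ge_minus_self[of "s * x * m"] x by (simp add: y_def abs_mult)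
    show ?thesis
    \<comment> \<open>For \<open>c \<ge> 0\<close> the two terms of \<open>m\<close> have opposite
      signs, which gives 1/6. Otherwise they may add up to 1/6 + 1/8 = 7/24, but then
      \<open>7/8 * (1 - c) * x\<^sup>2\<close> offsets most of \<open>- x\<^sup>2\<close>. Either
      way a quadratic in \<open>y\<close> without real roots remains, minimal at 4/33 and at 7/33
      respectively.\<close>
    proof (cases "c \<ge> 0")
      case True
      then have "\<bar>m\<bar> \<le> 1/6" using m_bound c1 unfolding m_def by (auto simp: abs_if)
      then have "y * \<bar>m\<bar> \<le> y * (1/6)" using y0 by (rule mult_left_mono)
      moreover have "7/8 * (1 - c) * x\<^sup>2 \<ge> 0" using c1 by (intro mult_nonneg_nonneg) auto
      moreover have "y\<^sup>2 * (11/16) - y * (1/6) + 1/48 \<ge> 0"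
        using zero_le_power2[of "y - 4/33"] by (simp add: power2_eq_square algebra_simps)
      ultimately show ?thesis using q sm x2 unfolding R_def by linarith
    next
      case False
      then have "\<bar>m\<bar> \<le> 7/24" using m_bound c1 unfolding m_def by (auto simp: abs_if)
      then have "y * \<bar>m\<bar> \<le> y * (7/24)" using y0 by (rule mult_left_mono)
      moreover have "7/8 * (1 - c) * x\<^sup>2 \<ge> 7/8 * x\<^sup>2"
        using False by (intro mult_right_mono) auto
      moreover have "y\<^sup>2 * (11/16) - y * (7/24) + 1/24 \<ge> 0"
        using zero_le_power2[of "y - 7/33"] by (simp add: power2_eq_square algebra_simps)
      ultimately show ?thesis using q sm x2 unfolding R_def by linarith
    qed
  qed
  ultimately show "((1 + c\<^sup>2) * x / 2 - s * x\<^sup>2)\<^sup>2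
           \<le> (1/6 - s * c * x / 2 + 2 * (1 - c) * x\<^sup>2) * (1/2 + s * c * x / 2)"
    by linarith
qed

lemma has_integral_cos_minus_chord_squared:
  fixes \<theta> \<phi> A :: real
  assumes "\<theta> \<noteq> 0"
  shows "((\<lambda>s. (cos (\<theta> * s + \<phi>) - s * A)\<^sup>2) has_integral
           1/2 + (sin (\<theta> + \<phi>) * cos (\<theta> + \<phi>) - sin \<phi> * cos \<phi>) / (2 * \<theta>)
           - 2 * A * (sin (\<theta> + \<phi>) / \<theta> + (cos (\<theta> + \<phi>) - cos \<phi>) / \<theta>\<^sup>2) + A\<^sup>2 / 3) {0..1}"
proof -
  define W where "W s = s / 2 + sin (\<theta> * s + \<phi>) * cos (\<theta> * s + \<phi>) / (2 * \<theta>)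
      - 2 * A * (s * sin (\<theta> * s + \<phi>) / \<theta> + cos (\<theta> * s + \<phi>) / \<theta>\<^sup>2) + s ^ 3 * A\<^sup>2 / 3" for s
  have "((\<lambda>s. (cos (\<theta> * s + \<phi>) - s * A)\<^sup>2) has_integral W 1 - W 0) {0..1}"
  proof (rule fundamental_theorem_of_calculus)
    fix s :: real
    define X where "X = \<theta> * s + \<phi>"
    have "(W has_real_derivative 1/2 + (cos X * cos X - sin X * sin X) / 2
        - 2 * A * (sin X / \<theta> + s * cos X - sin X / \<theta>) + s\<^sup>2 * A\<^sup>2) (at s within {0..1})"
      unfolding W_def X_def
      by (rule DERIV_cong, (rule derivative_intros | simp add: assms)+)
         (use assms in \<open>simp add: field_simps power2_eq_square power4_eq_xxxx\<close>)
    moreover have "sin X * sin X = 1 - cos X * cos X"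
      using sin_cos_squared_add[of X] by (simp add: power2_eq_square)
    ultimately have "(W has_real_derivative (cos X - s * A)\<^sup>2) (at s within {0..1})"
      by (simp add: power2_eq_square algebra_simps add_divide_distrib diff_divide_distrib)
    then show "(W has_vector_derivative (cos (\<theta> * s + \<phi>) - s * A)\<^sup>2) (at s within {0..1})"
      by (simp add: X_def has_real_derivative_iff_has_vector_derivative)
  qed simp
  moreover have "W 1 - W 0 = 1/2 + (sin (\<theta> + \<phi>) * cos (\<theta> + \<phi>) - sin \<phi> * cos \<phi>) / (2 * \<theta>)
      - 2 * A * (sin (\<theta> + \<phi>) / \<theta> + (cos (\<theta> + \<phi>) - cos \<phi>) / \<theta>\<^sup>2) + A\<^sup>2 / 3"
    by (simp add: W_def diff_divide_distrib add_divide_distrib right_diff_distrib distrib_left)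
  ultimately show ?thesis by simp
qed

text \<open>With the phase measured from the right end, one minus the integral becomes a quadratic
  form in \<open>A = cos (\<theta> + \<phi>)\<close> and \<open>S = sin (\<theta> + \<phi>)\<close>
  whose coefficients depend on \<theta> only. The discriminant estimate makes it nonnegative, as
  \<open>x = 1 / \<theta> \<le> 1/4\<close>.\<close>

lemma cos_minus_chord_L2:
  fixes \<theta> \<phi> :: real
  assumes "\<theta> \<ge> 4"
  shows "integral {0..1} (\<lambda>s. (cos (\<theta> * s + \<phi>) - s * cos (\<theta> + \<phi>))\<^sup>2) \<le> 1"
proof -
  define A S c s x where "A = cos (\<theta> + \<phi>)" and "S = sin (\<theta> + \<phi>)"
    and "c = cos \<theta>" and "s = sin \<theta>" and "x = 1 / \<theta>"
  have x: "0 \<le> x" "x \<le> 1/4" using assms by (auto simp: x_def field_simps)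
  have cs: "c\<^sup>2 + s\<^sup>2 = 1" and AS: "A\<^sup>2 + S\<^sup>2 = 1" by (simp_all add: c_def s_def A_def S_def)
  have cphi: "cos \<phi> = A * c + S * s" and sphi: "sin \<phi> = S * c - A * s"
    using cos_diff[of "\<theta> + \<phi>" \<theta>] sin_diff[of "\<theta> + \<phi>" \<theta>]
    by (simp_all add: A_def S_def c_def s_def algebra_simps)
  define p q r where "p = 1/6 - s * c * x / 2 + 2 * (1 - c) * x\<^sup>2"
    and "q = (1 + c\<^sup>2) * x / 2 - s * x\<^sup>2" and "r = 1/2 + s * c * x / 2"
  have "integral {0..1} (\<lambda>s. (cos (\<theta> * s + \<phi>) - s * cos (\<theta> + \<phi>))\<^sup>2)
      = 1/2 + (S * A - sin \<phi> * cos \<phi>) / (2 * \<theta>)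
        - 2 * A * (S / \<theta> + (A - cos \<phi>) / \<theta>\<^sup>2) + A\<^sup>2 / 3"
    unfolding A_def S_def
    by (rule integral_unique, rule has_integral_cos_minus_chord_squared) (use assms in simp)
  also have "\<dots> = 1/2 + (S * A - (S * c - A * s) * (A * c + S * s)) * x / 2
        - 2 * A * (S * x + (A - (A * c + S * s)) * x\<^sup>2) + A\<^sup>2 / 3"
    unfolding cphi sphi x_def by (simp add: power_divide)
  also have "\<dots> = (A\<^sup>2 + S\<^sup>2) - (p * A\<^sup>2 + 2 * q * A * S + r * S\<^sup>2)"
  proof -
    have s2: "s\<^sup>2 = 1 - c\<^sup>2" using cs by auto
    have "(S * c - A * s) * (A * c + S * s) = A * S * (c\<^sup>2 - s\<^sup>2) + (S\<^sup>2 - A\<^sup>2) * (s * c)"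
      by (simp add: power2_eq_square algebra_simps)
    then have e: "(S * c - A * s) * (A * c + S * s) = A * S * (2 * c\<^sup>2 - 1) + (S\<^sup>2 - A\<^sup>2) * (s * c)"
      by (simp add: s2)
    \<comment> \<open>The constant term is made homogeneous of degree two so that it joins the
      quadratic form.\<close>
    have half: "(1/2 :: real) = (A\<^sup>2 + S\<^sup>2) / 2" using AS by simp
    show ?thesis unfolding p_def q_def r_def e
      by (subst half) (simp add: power2_eq_square field_simps)
  qed
  also have "\<dots> \<le> 1"
    using quadratic_form_nonneg[of q p r A S] discriminant_estimate[OF cs x] AS
    by (simp add: p_def q_def r_def)
  finally show ?thesis .
qed

subsection \<open>Oscillatory integrals of Lipschitz functions\<close>

lemma integral_sin_by_parts:
  fixes K K' :: "real \<Rightarrow> real"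
  assumes K: "continuous_on {0..1} K" and K': "continuous_on {0..1} K'"
    and d: "\<And>s. 0 < s \<Longrightarrow> s < 1 \<Longrightarrow> (K has_real_derivative K' s) (at s)"
  shows "\<theta> * integral {0..1} (\<lambda>s. K s * sin (\<theta> * s + \<phi>))
           = K 0 * cos \<phi> - K 1 * cos (\<theta> + \<phi>) + integral {0..1} (\<lambda>s. K' s * cos (\<theta> * s + \<phi>))"
proof -
  have "((\<lambda>s. \<theta> * (K s * sin (\<theta> * s + \<phi>)) - K' s * cos (\<theta> * s + \<phi>)) has_integral
          (- K 1 * cos (\<theta> * 1 + \<phi>)) - (- K 0 * cos (\<theta> * 0 + \<phi>))) {0..1}"
  proof (rule fundamental_theorem_of_calculus_interior)
    show "continuous_on {0..1} (\<lambda>s. - K s * cos (\<theta> * s + \<phi>))"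
      by (intro continuous_intros K)
    fix s :: real assume "s \<in> {0<..<1}"
    then have "(K has_real_derivative K' s) (at s)" using d by auto
    then have "((\<lambda>s. - K s * cos (\<theta> * s + \<phi>)) has_real_derivative
        \<theta> * (K s * sin (\<theta> * s + \<phi>)) - K' s * cos (\<theta> * s + \<phi>)) (at s)"
      by (auto intro!: derivative_eq_intros)
    then show "((\<lambda>s. - K s * cos (\<theta> * s + \<phi>)) has_vector_derivative
        \<theta> * (K s * sin (\<theta> * s + \<phi>)) - K' s * cos (\<theta> * s + \<phi>)) (at s)"
      by (simp add: has_real_derivative_iff_has_vector_derivative)
  qed simp
  then have "integral {0..1} (\<lambda>s. \<theta> * (K s * sin (\<theta> * s + \<phi>)) - K' s * cos (\<theta> * s + \<phi>))
      = K 0 * cos \<phi> - K 1 * cos (\<theta> + \<phi>)"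
    by (simp add: integral_unique)
  moreover have "integral {0..1} (\<lambda>s. \<theta> * (K s * sin (\<theta> * s + \<phi>)) - K' s * cos (\<theta> * s + \<phi>))
      = integral {0..1} (\<lambda>s. \<theta> * (K s * sin (\<theta> * s + \<phi>)))
        - integral {0..1} (\<lambda>s. K' s * cos (\<theta> * s + \<phi>))"
    by (intro integral_diff integrable_continuous_interval continuous_intros K K')
  ultimately show ?thesis by simp
qed

text \<open>The weight s vanishes at 0, so integration by parts leaves only the boundary value at
  1.\<close>

lemma integral_moment_derivative:
  fixes K K' :: "real \<Rightarrow> real"
  assumes K: "continuous_on {0..1} K" and K': "continuous_on {0..1} K'"
    and d: "\<And>s. 0 < s \<Longrightarrow> s < 1 \<Longrightarrow> (K has_real_derivative K' s) (at s)"
  shows "integral {0..1} (\<lambda>s. s * K' s) = K 1 - integral {0..1} K"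
proof -
  have "((\<lambda>s. K s + s * K' s) has_integral 1 * K 1 - 0 * K 0) {0..1}"
  proof (rule fundamental_theorem_of_calculus_interior)
    show "continuous_on {0..1} (\<lambda>s. s * K s)" by (intro continuous_intros K)
    fix s :: real assume "s \<in> {0<..<1}"
    then have "(K has_real_derivative K' s) (at s)" using d by auto
    then have "((\<lambda>s. s * K s) has_real_derivative K s + s * K' s) (at s)"
      by (auto intro!: derivative_eq_intros)
    then show "((\<lambda>s. s * K s) has_vector_derivative K s + s * K' s) (at s)"
      by (simp add: has_real_derivative_iff_has_vector_derivative)
  qed simp
  then have "integral {0..1} (\<lambda>s. K s + s * K' s) = K 1" by (simp add: integral_unique)
  moreover have "integral {0..1} (\<lambda>s. K s + s * K' s)
      = integral {0..1} K + integral {0..1} (\<lambda>s. s * K' s)"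
    by (intro integral_add integrable_continuous_interval continuous_intros K K')
  ultimately show ?thesis by simp
qed

lemma abs_integral_mult_le:
  fixes f h :: "real \<Rightarrow> real"
  assumes f: "continuous_on {0..1} f" and h: "continuous_on {0..1} h"
    and B: "\<And>s. s \<in> {0..1} \<Longrightarrow> \<bar>f s\<bar> \<le> B" and h1: "integral {0..1} (\<lambda>s. \<bar>h s\<bar>) \<le> 1"
  shows "\<bar>integral {0..1} (\<lambda>s. f s * h s)\<bar> \<le> B"
proof -
  have "B \<ge> 0" using B[of 0] by force
  have "norm (integral {0..1} (\<lambda>s. f s * h s)) \<le> integral {0..1} (\<lambda>s. B * \<bar>h s\<bar>)"
  proof (rule integral_norm_bound_integral)
    show "(\<lambda>s. f s * h s) integrable_on {0..1}" "(\<lambda>s. B * \<bar>h s\<bar>) integrable_on {0..1}"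
      by (intro integrable_continuous_interval continuous_intros f h)+
    fix s :: real assume "s \<in> {0..1}"
    then show "norm (f s * h s) \<le> B * \<bar>h s\<bar>"
      using B by (simp add: abs_mult mult_right_mono)
  qed
  also have "\<dots> \<le> B" using h1 \<open>B \<ge> 0\<close> by (simp add: mult_left_le)
  finally show ?thesis by simp
qed

text \<open>In the reversed time used below, the point 1 is the initial time of the original
  function. Its vanishing there removes one of the two boundary terms of the integration by
  parts.\<close>

lemma sin_integral_bound_zero_end:
  fixes K K' :: "real \<Rightarrow> real"
  assumes K: "continuous_on {0..1} K" and K': "continuous_on {0..1} K'"
    and d: "\<And>s. 0 < s \<Longrightarrow> s < 1 \<Longrightarrow> (K has_real_derivative K' s) (at s)"
    and B: "\<And>s. s \<in> {0..1} \<Longrightarrow> \<bar>K' s\<bar> \<le> B" and "K 1 = 0"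
  shows "\<bar>\<theta> * integral {0..1} (\<lambda>s. K s * sin (\<theta> * s + \<phi>))\<bar> \<le> B + \<bar>K 0\<bar>"
proof -
  have "integral {0..1} (\<lambda>s. \<bar>cos (\<theta> * s + \<phi>)\<bar>) \<le> integral {0..1} (\<lambda>s::real. 1)"
    by (intro integral_le integrable_continuous_interval continuous_intros) auto
  then have "integral {0..1} (\<lambda>s. \<bar>cos (\<theta> * s + \<phi>)\<bar>) \<le> 1" by simp
  then have "\<bar>integral {0..1} (\<lambda>s. K' s * cos (\<theta> * s + \<phi>))\<bar> \<le> B"
    by (intro abs_integral_mult_le K' B continuous_intros)
  moreover have "\<bar>K 0 * cos \<phi>\<bar> \<le> \<bar>K 0\<bar>" by (simp add: abs_mult mult_left_le)
  ultimately show ?thesis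
    using integral_sin_by_parts[OF K K' d, of \<theta> \<phi>] \<open>K 1 = 0\<close> by simp
qed

text \<open>Since \<open>K\<close> has mean zero, \<open>K 1\<close> is the integral of \<open>s * K' s\<close>. Hence the boundary term at \<open>1\<close>
  only replaces the cosine by its difference to a chord, whose \<open>L\<^sup>1\<close> norm is still at most \<open>1\<close>.\<close>

lemma sin_integral_bound_high_frequency:
  fixes K K' :: "real \<Rightarrow> real"
  assumes K: "continuous_on {0..1} K" and K': "continuous_on {0..1} K'"
    and d: "\<And>s. 0 < s \<Longrightarrow> s < 1 \<Longrightarrow> (K has_real_derivative K' s) (at s)"
    and B: "\<And>s. s \<in> {0..1} \<Longrightarrow> \<bar>K' s\<bar> \<le> B"
    and mean: "integral {0..1} K = 0" and "\<theta> \<ge> 4"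
  shows "\<bar>\<theta> * integral {0..1} (\<lambda>s. K s * sin (\<theta> * s + \<phi>))\<bar> \<le> B + \<bar>K 0\<bar>"
proof -
  define h where "h s = cos (\<theta> * s + \<phi>) - s * cos (\<theta> + \<phi>)" for s
  have h: "continuous_on {0..1} h" unfolding h_def by (intro continuous_intros)
  \<comment> \<open>The inequality \<open>\<bar>h\<bar> \<le> (1 + h\<^sup>2) / 2\<close> turns the
    bound 1 on the integral of the square into the bound 1 on the integral of the absolute
    value.\<close>
  have "integral {0..1} (\<lambda>s. \<bar>h s\<bar>) \<le> integral {0..1} (\<lambda>s. 1/2 + (h s)\<^sup>2 / 2)"
  proof (intro integral_le integrable_continuous_interval continuous_intros h)
    fix s
    show "\<bar>h s\<bar> \<le> 1/2 + (h s)\<^sup>2 / 2"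
      using zero_le_power2[of "\<bar>h s\<bar> - 1"] by (simp add: power2_diff)
  qed simp
  also have "\<dots> = integral {0..1} (\<lambda>s::real. 1/2) + integral {0..1} (\<lambda>s. (h s)\<^sup>2 / 2)"
    by (intro integral_add integrable_continuous_interval continuous_intros h) simp
  also have "\<dots> \<le> 1" using cos_minus_chord_L2[OF \<open>\<theta> \<ge> 4\<close>, of \<phi>] by (simp add: h_def)
  finally have "\<bar>integral {0..1} (\<lambda>s. K' s * h s)\<bar> \<le> B"
    by (intro abs_integral_mult_le K' B h)
  moreover have "integral {0..1} (\<lambda>s. K' s * h s)
      = integral {0..1} (\<lambda>s. K' s * cos (\<theta> * s + \<phi>) - cos (\<theta> + \<phi>) * (s * K' s))"
    by (simp add: h_def algebra_simps)
  moreover have "\<dots> = integral {0..1} (\<lambda>s. K' s * cos (\<theta> * s + \<phi>))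
      - integral {0..1} (\<lambda>s. cos (\<theta> + \<phi>) * (s * K' s))"
    by (intro integral_diff integrable_continuous_interval continuous_intros K')
  moreover have "\<bar>K 0 * cos \<phi>\<bar> \<le> \<bar>K 0\<bar>" by (simp add: abs_mult mult_left_le)
  ultimately show ?thesis
    using integral_sin_by_parts[OF K K' d, of \<theta> \<phi>] integral_moment_derivative[OF K K' d] mean
    by (simp add: mult.commute)
qed

section \<open>Low frequencies: a mean square estimate for functions of mean zero\<close>

text \<open>Subtracting a constant from a function of mean zero can only increase its mean square.
  With the constant \<open>K (1/2)\<close> the mean value theorem bounds the difference by
  \<open>B * \<bar>s - 1/2\<bar>\<close>, and the square of \<open>s - 1/2\<close> integrates to
  1/12.\<close>

lemma mean_zero_L2_bound:
  fixes K K' :: "real \<Rightarrow> real"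
  assumes K: "continuous_on {0..1} K"
    and d: "\<And>s. 0 < s \<Longrightarrow> s < 1 \<Longrightarrow> (K has_real_derivative K' s) (at s)"
    and B: "\<And>s. s \<in> {0..1} \<Longrightarrow> \<bar>K' s\<bar> \<le> B" and mean: "integral {0..1} K = 0"
  shows "integral {0..1} (\<lambda>s. (K s)\<^sup>2) \<le> B\<^sup>2 / 12"
proof -
  define a where "a = K (1/2)"
  have lip: "\<bar>K s - a\<bar> \<le> B * \<bar>s - 1/2\<bar>" if s: "s \<in> {0..1}" for s
  proof -
    have B0: "\<bar>K v - K u\<bar> \<le> B * \<bar>v - u\<bar>" if uv: "0 \<le> u" "u < v" "v \<le> 1" for u v
    proof -
      have "continuous_on {u..v} K" using uv by (intro continuous_on_subset[OF K]) auto
      then obtain z where z: "u < z" "z < v" "K v - K u = K' z * (v - u)"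
        using mvt[of u v K "\<lambda>x. (*) (K' x)"] uv d by (auto simp: has_field_derivative_def)
      then have "\<bar>K v - K u\<bar> = \<bar>K' z\<bar> * \<bar>v - u\<bar>" by (simp add: abs_mult)
      also have "\<dots> \<le> B * \<bar>v - u\<bar>" using B z uv by (intro mult_right_mono) auto
      finally show ?thesis .
    qed
    show ?thesis
    proof (cases s "1/2 :: real" rule: linorder_cases)
      case equal
      show ?thesis unfolding a_def equal by simp
    qed (use B0[of s "1/2"] B0[of "1/2" s] s in \<open>auto simp: a_def abs_minus_commute\<close>)
  qed
  have "((\<lambda>s::real. (s - 1/2)\<^sup>2) has_integral (1 - 1/2) ^ 3 / 3 - (0 - 1/2) ^ 3 / 3) {0..1}"
  proof (rule fundamental_theorem_of_calculus)
    fix s :: real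
    have "((\<lambda>s. (s - 1/2) ^ 3 / 3) has_real_derivative (s - 1/2)\<^sup>2) (at s within {0..1})"
      by (rule DERIV_cong, (rule derivative_intros | simp)+)
    then show "((\<lambda>s. (s - 1/2) ^ 3 / 3) has_vector_derivative (s - 1/2)\<^sup>2) (at s within {0..1})"
      by (simp only: has_real_derivative_iff_has_vector_derivative)
  qed simp
  then have twelfth: "integral {0..1} (\<lambda>s::real. (s - 1/2)\<^sup>2) = 1/12"
    by (simp add: integral_unique power3_eq_cube)
  have "integral {0..1} (\<lambda>s. (K s - a)\<^sup>2)
      = integral {0..1} (\<lambda>s. (K s)\<^sup>2 - (2 * a) * K s + a\<^sup>2)"
    by (simp add: power2_diff algebra_simps)
  also have "\<dots> = integral {0..1} (\<lambda>s. (K s)\<^sup>2) - integral {0..1} (\<lambda>s. (2 * a) * K s)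
      + integral {0..1} (\<lambda>s::real. a\<^sup>2)"
    by (subst integral_add integral_diff;
        (intro integrable_continuous_interval continuous_intros K)?)+ simp
  finally have "integral {0..1} (\<lambda>s. (K s)\<^sup>2) \<le> integral {0..1} (\<lambda>s. (K s - a)\<^sup>2)"
    using mean by simp
  also have "\<dots> \<le> integral {0..1} (\<lambda>s. B\<^sup>2 * (s - 1/2)\<^sup>2)"
  proof (intro integral_le integrable_continuous_interval continuous_intros K)
    fix s :: real assume "s \<in> {0..1}"
    then have "\<bar>K s - a\<bar>\<^sup>2 \<le> (B * \<bar>s - 1/2\<bar>)\<^sup>2" using lip by (intro power_mono) auto
    then show "(K s - a)\<^sup>2 \<le> B\<^sup>2 * (s - 1/2)\<^sup>2" by (simp add: power_mult_distrib)
  qed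
  also have "\<dots> = B\<^sup>2 / 12" by (simp add: twelfth)
  finally show ?thesis .
qed

lemma integral_sin_squared_le:
  fixes \<theta> :: real
  assumes "\<theta> > 0"
  shows "integral {0..1} (\<lambda>s. (sin (\<theta> * s + \<phi>))\<^sup>2) \<le> 1/2 + 1 / (2 * \<theta>)"
proof -
  have ne: "\<theta> \<noteq> 0" using assms by simp
  define W where "W s = s / 2 - sin (\<theta> * s + \<phi>) * cos (\<theta> * s + \<phi>) / (2 * \<theta>)" for s
  have "((\<lambda>s. (sin (\<theta> * s + \<phi>))\<^sup>2) has_integral W 1 - W 0) {0..1}"
  proof (rule fundamental_theorem_of_calculus)
    fix s :: real
    define X where "X = \<theta> * s + \<phi>"
    have "(W has_real_derivative 1/2 - (cos X * cos X - sin X * sin X) / 2) (at s within {0..1})"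
      unfolding W_def X_def
      by (rule DERIV_cong, (rule derivative_intros | simp add: ne)+)
         (use ne in \<open>simp add: field_simps power2_eq_square\<close>)
    moreover have "cos X * cos X = 1 - sin X * sin X"
      using sin_cos_squared_add[of X] by (simp add: power2_eq_square)
    ultimately have "(W has_real_derivative (sin X)\<^sup>2) (at s within {0..1})"
      by (simp add: power2_eq_square diff_divide_distrib)
    then show "(W has_vector_derivative (sin (\<theta> * s + \<phi>))\<^sup>2) (at s within {0..1})"
      by (simp add: X_def has_real_derivative_iff_has_vector_derivative)
  qed simp
  then have "integral {0..1} (\<lambda>s. (sin (\<theta> * s + \<phi>))\<^sup>2) = W 1 - W 0" by (rule integral_unique)
  also have "\<dots> = 1/2 + (sin \<phi> * cos \<phi> - sin (\<theta> + \<phi>) * cos (\<theta> + \<phi>)) / (2 * \<theta>)"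
    by (simp add: W_def diff_divide_distrib)
  also have "\<dots> \<le> 1/2 + 1 / (2 * \<theta>)"
  proof -
    have "\<bar>sin z * cos z\<bar> \<le> 1/2" for z :: real
      using sum_squares_bound[of "sin z" "cos z"] sum_squares_bound[of "sin z" "- cos z"]
      by (simp add: abs_le_iff algebra_simps)
    from this[of \<phi>] this[of "\<theta> + \<phi>"]
    have "sin \<phi> * cos \<phi> - sin (\<theta> + \<phi>) * cos (\<theta> + \<phi>) \<le> 1" by linarith
    then show ?thesis using assms by (simp add: divide_right_mono)
  qed
  finally show ?thesis .
qed

text \<open>Young's inequality with a weight \<open>\<mu>\<close> combines the mean squares of
  \<open>K\<close> and of the sine into the bound \<open>D * (5 * \<theta> + 2) / 24\<close>, which
  is at most \<open>D * 22 / 24\<close> for \<open>\<theta> \<le> 4\<close>.\<close>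

lemma sin_integral_bound_low_frequency:
  fixes K K' :: "real \<Rightarrow> real"
  assumes K: "continuous_on {0..1} K"
    and d: "\<And>s. 0 < s \<Longrightarrow> s < 1 \<Longrightarrow> (K has_real_derivative K' s) (at s)"
    and B: "\<And>s. s \<in> {0..1} \<Longrightarrow> \<bar>K' s\<bar> \<le> B"
    and mean: "integral {0..1} K = 0" and \<theta>: "\<theta> > 0" "\<theta> \<le> 4"
  shows "\<bar>\<theta> * integral {0..1} (\<lambda>s. K s * sin (\<theta> * s + \<phi>))\<bar> \<le> B"
proof -
  define S where "S s = sin (\<theta> * s + \<phi>)" for s
  have S: "continuous_on {0..1} S" unfolding S_def by (intro continuous_intros)
  \<comment> \<open>The bound \<open>B\<close> may be 0, whereas the weight needs a positive
    \<open>D\<close>; letting \<open>D\<close> decrease to \<open>B\<close> at the end recovers the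
    claim.\<close>
  have pos: "\<bar>\<theta> * integral {0..1} (\<lambda>s. K s * S s)\<bar> \<le> D" if D: "D > B" for D
  proof -
    have "D > 0" using D B[of 0] by force
    \<comment> \<open>The two terms balance at \<open>\<theta> = 4\<close> for the weight
      \<open>sqrt (15/2) / D\<close>, about \<open>2.74 / D\<close>; \<open>3 / D\<close> is a round
      value close to it.\<close>
    define \<mu> where "\<mu> = 3 / D"
    have \<mu>: "\<mu> > 0" "\<mu> * D = 3" using \<open>D > 0\<close> by (auto simp: \<mu>_def)
    have "norm (integral {0..1} (\<lambda>s. K s * S s))
        \<le> integral {0..1} (\<lambda>s. \<mu> / 2 * (K s)\<^sup>2 + 1 / (2 * \<mu>) * (S s)\<^sup>2)"
    proof (intro integral_norm_bound_integral integrable_continuous_interval continuous_intros K S)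
      fix s :: real
      show "norm (K s * S s) \<le> \<mu> / 2 * (K s)\<^sup>2 + 1 / (2 * \<mu>) * (S s)\<^sup>2"
        using zero_le_power2[of "\<mu> * \<bar>K s\<bar> - \<bar>S s\<bar>"] \<mu>
        by (simp add: field_simps power2_eq_square abs_mult)
    qed
    also have "\<dots> = \<mu> / 2 * integral {0..1} (\<lambda>s. (K s)\<^sup>2)
        + 1 / (2 * \<mu>) * integral {0..1} (\<lambda>s. (S s)\<^sup>2)"
      by (subst integral_add; (intro integrable_continuous_interval continuous_intros K S)?) simp
    also have "\<dots> \<le> \<mu> / 2 * (D\<^sup>2 / 12) + 1 / (2 * \<mu>) * (1/2 + 1 / (2 * \<theta>))"
    proof (intro add_mono mult_left_mono)
      have BD: "\<bar>K' s\<bar> \<le> D" if "s \<in> {0..1}" for s using B[OF that] D by simp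
      show "integral {0..1} (\<lambda>s. (K s)\<^sup>2) \<le> D\<^sup>2 / 12"
        by (rule mean_zero_L2_bound[OF K d BD mean])
      show "integral {0..1} (\<lambda>s. (S s)\<^sup>2) \<le> 1/2 + 1 / (2 * \<theta>)"
        unfolding S_def by (rule integral_sin_squared_le) fact
    qed (use \<mu> in auto)
    finally have "\<theta> * \<bar>integral {0..1} (\<lambda>s. K s * S s)\<bar>
        \<le> \<theta> * (\<mu> / 2 * (D\<^sup>2 / 12) + 1 / (2 * \<mu>) * (1/2 + 1 / (2 * \<theta>)))"
      using \<theta> by simp
    also have "\<dots> = D * (5 * \<theta> + 2) / 24"
      using \<theta> \<open>D > 0\<close> by (simp add: \<mu>_def field_simps power2_eq_square)
    also have "\<dots> \<le> D * 22 / 24"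
      using \<theta> \<open>D > 0\<close> by (intro divide_right_mono mult_left_mono) auto
    also have "\<dots> \<le> D" using \<open>D > 0\<close> by simp
    finally show ?thesis using \<theta> by (simp add: abs_mult)
  qed
  show ?thesis using dense_ge[OF pos] by (simp add: S_def)
qed

section \<open>Time reversal and rescaling to the unit interval\<close>

lemma has_integral_reflect_scale:
  fixes f :: "real \<Rightarrow> real"
  assumes f: "(f has_integral i) {0..T}" and m: "m > 0"
  shows "((\<lambda>s. f (T - m * s)) has_integral i / m) {0..T / m}"
proof -
  have "((\<lambda>x. f (- x)) has_integral i) (cbox (- T) (- 0))"
    using f by (subst interval_cbox[symmetric], subst has_integral_reflect_real)
  from has_integral_affinity'[OF this m, of "- T"] show ?thesis
    using m by (simp add: divide_inverse mult.commute)
qed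

text \<open>The substitution \<open>t = T - T * s\<close> turns the noise into
  \<open>sin (\<omega> * T * s + \<phi>)\<close>, moves \<open>G T\<close> to \<open>K 0\<close> and
  \<open>G 0\<close> to \<open>K 1\<close>, and multiplies the bound of the derivative by
  \<open>T\<close>. The three estimates on the unit interval then apply with
  \<open>\<theta> = \<omega> * T\<close>.\<close>

lemma modulated_noise_bound:
  fixes G H :: "real \<Rightarrow> real"
  assumes "T > 0" "\<omega> > 0"
    and G: "continuous_on {0..T} G" and H: "continuous_on {0..T} H"
    and d: "\<And>t. 0 < t \<Longrightarrow> t < T \<Longrightarrow> (G has_real_derivative H t) (at t)"
    and C: "\<And>t. t \<in> {0..T} \<Longrightarrow> \<bar>H t\<bar> \<le> C"
    and zero: "G 0 = 0 \<or> integral {0..T} G = 0"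
  shows "\<omega> * \<bar>integral {0..T} (\<lambda>t. G t * sin (\<omega> * (T - t) + \<phi>))\<bar> \<le> T * C + \<bar>G T\<bar>"
proof -
  define K K' where "K s = G (T - T * s)" and "K' s = - T * H (T - T * s)" for s
  have in_T: "T - T * s \<in> {0..T}" if "s \<in> {0..1}" for s
    using that \<open>T > 0\<close> by (auto simp: mult_left_le)
  have affine: "continuous_on {0..1} (\<lambda>s. T - T * s)" by (intro continuous_intros)
  have K: "continuous_on {0..1} K" unfolding K_def
    by (rule continuous_on_compose2[OF G affine]) (use in_T in auto)
  have K': "continuous_on {0..1} K'" unfolding K'_def
    by (intro continuous_intros continuous_on_compose2[OF H affine]) (use in_T in auto)
  have dK: "(K has_real_derivative K' s) (at s)" if "0 < s" "s < 1" for s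
  proof -
    have "0 < T - T * s" "T - T * s < T" using that \<open>T > 0\<close> by auto
    then have "(G has_real_derivative H (T - T * s)) (at (T - T * s))" by (rule d)
    moreover have "((\<lambda>s. T - T * s) has_real_derivative - T) (at s)"
      by (auto intro!: derivative_eq_intros)
    ultimately show ?thesis
      using DERIV_chain2[of G "H (T - T * s)" "\<lambda>s. T - T * s" s "- T" UNIV]
      by (simp add: K_def[abs_def] K'_def mult.commute)
  qed
  have B: "\<bar>K' s\<bar> \<le> T * C" if "s \<in> {0..1}" for s
    using C[OF in_T[OF that]] \<open>T > 0\<close> by (simp add: K'_def abs_mult)
  have rescale: "integral {0..T} f = T * integral {0..1} (\<lambda>s. f (T - T * s))"
    if "continuous_on {0..T} f" for f :: "real \<Rightarrow> real"
  proof -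
    have "(f has_integral integral {0..T} f) {0..T}"
      using integrable_continuous_interval[OF that] by (rule integrable_integral)
    from has_integral_reflect_scale[OF this \<open>T > 0\<close>] show ?thesis
      using \<open>T > 0\<close> by (simp add: integral_unique)
  qed
  have "\<bar>(\<omega> * T) * integral {0..1} (\<lambda>s. K s * sin (\<omega> * T * s + \<phi>))\<bar> \<le> T * C + \<bar>K 0\<bar>"
  proof (cases "G 0 = 0")
    case True
    then show ?thesis by (intro sin_integral_bound_zero_end[OF K K' dK B]) (simp_all add: K_def)
  next
    case False
    then have "integral {0..1} K = 0" using zero rescale[OF G] \<open>T > 0\<close> by (simp add: K_def[abs_def])
    moreover have "\<omega> * T > 0" using \<open>T > 0\<close> \<open>\<omega> > 0\<close> by simp
    \<comment> \<open>The frequency ranges meet at 4: the chord estimate covers everything from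
      there on, and \<open>(5 * \<theta> + 2) / 24\<close> stays below 1 up to
      \<open>\<theta> = 22/5\<close>.\<close>
    ultimately show ?thesis
      using sin_integral_bound_high_frequency[OF K K' dK B, of "\<omega> * T" \<phi>]
        sin_integral_bound_low_frequency[OF K dK B, of "\<omega> * T" \<phi>]
      by (cases "\<omega> * T \<ge> 4") auto
  qed
  moreover have "integral {0..T} (\<lambda>t. G t * sin (\<omega> * (T - t) + \<phi>))
      = T * integral {0..1} (\<lambda>s. K s * sin (\<omega> * T * s + \<phi>))"
    by (subst rescale) (auto intro!: continuous_intros G simp: K_def mult.assoc)
  ultimately show ?thesis
    using \<open>\<omega> > 0\<close> by (simp add: K_def abs_mult mult.assoc)
qed

subsection \<open>Limits at zero of iterated derivatives\<close>

text \<open>A derivative with a limit is bounded near 0, so the function is Lipschitz there, hence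
  uniformly continuous, and extends to the closure point 0.\<close>

lemma tendsto_at_right_of_derivative_limit:
  fixes f f' :: "real \<Rightarrow> real"
  assumes "T > 0" and d: "\<And>t. 0 < t \<Longrightarrow> t < T \<Longrightarrow> (f has_real_derivative f' t) (at t)"
    and lim: "(f' \<longlongrightarrow> v) (at_right 0)"
  obtains u where "(f \<longlongrightarrow> u) (at_right 0)"
proof -
  have "\<forall>\<^sub>F t in at_right 0. dist (f' t) v < 1" using lim by (rule tendstoD) simp
  then obtain b where b: "b > 0" "\<And>t. 0 < t \<Longrightarrow> t < b \<Longrightarrow> dist (f' t) v < 1"
    by (auto simp: eventually_at_right_field)
  define X where "X = {0<..<min b T}"
  have lip: "norm (f x - f y) \<le> (\<bar>v\<bar> + 1) * norm (x - y)" if "x \<in> X" "y \<in> X" for x y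
  proof (rule field_differentiable_bound[of X f f'])
    fix z assume "z \<in> X"
    then show "(f has_real_derivative f' z) (at z within X)" "norm (f' z) \<le> \<bar>v\<bar> + 1"
      using d[of z] b(2)[of z] by (auto simp: X_def dist_real_def intro: has_field_derivative_at_within)
  qed (use that in \<open>auto simp: X_def\<close>)
  then have "(\<bar>v\<bar> + 1)-lipschitz_on X f"
    by (intro lipschitz_onI) (auto simp: dist_norm)
  then have "uniformly_continuous_on X f" by (rule lipschitz_on_uniformly_continuous)
  moreover have "0 \<in> closure X" using \<open>T > 0\<close> b by (simp add: X_def)
  ultimately obtain u where "(f \<longlongrightarrow> u) (at 0 within X)"
    by (rule uniformly_continuous_on_extension_at_closure)
  moreover have "at 0 within X = at_right (0::real)"
    unfolding X_def using \<open>T > 0\<close> b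
    by (intro at_within_nhd[of 0 "{..<min b T}"]) auto
  ultimately show ?thesis using that by simp
qed

text \<open>This is the leading Taylor coefficient at 0 of a function known only to the right of 0,
  obtained by iterating the rule of l'Hopital.\<close>

lemma tendsto_div_power_of_derivatives:
  fixes f :: "nat \<Rightarrow> real \<Rightarrow> real"
  assumes "T > 0"
    and d: "\<And>j t. j < m \<Longrightarrow> 0 < t \<Longrightarrow> t < T \<Longrightarrow> (f j has_real_derivative f (Suc j) t) (at t)"
    and zero: "\<And>j. j < m \<Longrightarrow> (f j \<longlongrightarrow> 0) (at_right 0)"
    and lim: "(f m \<longlongrightarrow> v) (at_right 0)"
  shows "((\<lambda>t. f 0 t / t ^ m) \<longlongrightarrow> v / fact m) (at_right 0)"
proof -
  \<comment> \<open>The induction starts at the highest derivative and integrates once per step,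
    each step contributing a factor \<open>Suc i\<close> to the factorial.\<close>
  have "((\<lambda>t. f (m - i) t / t ^ i) \<longlongrightarrow> v / fact i) (at_right 0)" if "i \<le> m" for i
    using that
  proof (induction i)
    case 0
    then show ?case using lim by simp
  next
    case (Suc i)
    have Suc_diff: "Suc (m - Suc i) = m - i" using Suc.prems by simp
    have pos: "eventually (\<lambda>t::real. 0 < t \<and> t < T) (at_right 0)"
      using \<open>T > 0\<close> by (auto simp: eventually_at_right_field)
    show ?case
    proof (rule lhopital_right_0[where g' = "\<lambda>t. real (Suc i) * t ^ i"])
      show "(f (m - Suc i) \<longlongrightarrow> 0) (at_right 0)" using zero Suc.prems by simp
      show "((\<lambda>t::real. t ^ Suc i) \<longlongrightarrow> 0) (at_right 0)"
        by (auto intro!: tendsto_eq_intros)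
      show "eventually (\<lambda>t::real. t ^ Suc i \<noteq> 0) (at_right 0)"
        "eventually (\<lambda>t. real (Suc i) * t ^ i \<noteq> 0) (at_right 0)"
        by (rule eventually_mono[OF pos], force)+
      show "eventually (\<lambda>t. (f (m - Suc i) has_real_derivative f (m - i) t) (at t)) (at_right 0)"
        using pos d[of "m - Suc i"] Suc.prems by (auto elim!: eventually_mono simp: Suc_diff)
      show "eventually (\<lambda>t. ((\<lambda>t. t ^ Suc i) has_real_derivative real (Suc i) * t ^ i) (at t)) (at_right 0)"
        by (intro always_eventually allI) (auto intro!: derivative_eq_intros simp del: power_Suc)
      have "((\<lambda>t. f (m - i) t / t ^ i / real (Suc i)) \<longlongrightarrow> v / fact i / real (Suc i)) (at_right 0)"
        by (rule tendsto_divide[OF _ tendsto_const]) (use Suc in auto)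
      then show "((\<lambda>t. f (m - i) t / (real (Suc i) * t ^ i)) \<longlongrightarrow> v / fact (Suc i)) (at_right 0)"
        by (simp add: mult.commute)
    qed
  qed
  from this[of m] show ?thesis by simp
qed

text \<open>Existence of limits descends from order \<open>k\<close> to order 0. Their vanishing
  then ascends: if all derivatives below order \<open>j\<close> tend to 0, the quotient
  \<open>f 0 t / t ^ j\<close> tends to the limit of \<open>f j\<close> divided by
  \<open>fact j\<close>, while smallness of \<open>f 0\<close> sends the same quotient to 0.\<close>

lemma derivative_limit_zero:
  fixes f :: "nat \<Rightarrow> real \<Rightarrow> real"
  assumes "T > 0"
    and d: "\<And>j t. j < k \<Longrightarrow> 0 < t \<Longrightarrow> t < T \<Longrightarrow> (f j has_real_derivative f (Suc j) t) (at t)"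
    and lim: "(f k \<longlongrightarrow> v) (at_right 0)"
    and small: "((\<lambda>t. f 0 t / t ^ k) \<longlongrightarrow> 0) (at_right 0)"
  shows "v = 0"
proof -
  have limits: "\<exists>u. (f (k - i) \<longlongrightarrow> u) (at_right 0)" if "i \<le> k" for i
    using that
  proof (induction i)
    case 0
    then show ?case using lim by auto
  next
    case (Suc i)
    then obtain u where u: "(f (k - i) \<longlongrightarrow> u) (at_right 0)" by auto
    have "Suc (k - Suc i) = k - i" using Suc.prems by simp
    then have "(f (k - Suc i) has_real_derivative f (k - i) t) (at t)" if "0 < t" "t < T" for t
      using d[of "k - Suc i" t] that Suc.prems by simp
    from tendsto_at_right_of_derivative_limit[OF \<open>T > 0\<close> this u] show ?case by blast
  qed
  have "(f j \<longlongrightarrow> 0) (at_right 0)" if "j \<le> k" for j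
    using that
  proof (induction j rule: less_induct)
    case (less j)
    obtain u where u: "(f j \<longlongrightarrow> u) (at_right 0)"
      using limits[of "k - j"] less.prems by auto
    have "((\<lambda>t. f 0 t / t ^ j) \<longlongrightarrow> u / fact j) (at_right 0)"
      by (rule tendsto_div_power_of_derivatives[where f = f and m = j, OF \<open>T > 0\<close> _ _ u])
         (use d less in auto)
    moreover have "((\<lambda>t. f 0 t / t ^ j) \<longlongrightarrow> 0) (at_right 0)"
    proof (rule Lim_transform_eventually)
      have "((\<lambda>t. f 0 t / t ^ k * t ^ (k - j)) \<longlongrightarrow> 0 * 0 ^ (k - j)) (at_right 0)"
        by (intro tendsto_intros small)
      then show "((\<lambda>t. f 0 t / t ^ k * t ^ (k - j)) \<longlongrightarrow> 0) (at_right 0)" by simp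
      have "f 0 t / t ^ k * t ^ (k - j) = f 0 t / t ^ j" if "t > 0" for t
        using that less.prems by (simp add: power_diff)
      then show "\<forall>\<^sub>F t in at_right 0. f 0 t / t ^ k * t ^ (k - j) = f 0 t / t ^ j"
        using eventually_at_right_less[of "0::real"] by (auto elim!: eventually_mono)
    qed
    ultimately have "u / fact j = 0"
      by (rule tendsto_unique[OF trivial_limit_at_right_real])
    then show ?case using u by simp
  qed
  from this[of k] show ?thesis using tendsto_unique[OF trivial_limit_at_right_real lim] by simp
qed

subsection \<open>Riemann-Liouville derivatives of modulating functions\<close>

lemma deriv_within_has_real_derivative:
  assumes "times_differentiable_on k f S" "j < k" "t \<in> S"
  shows "(deriv_within j S f has_real_derivative deriv_within (Suc j) S f t) (at t within S)"
  using assms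
  by (simp add: times_differentiable_on_def differentiable_on_def vector_derivative_works
      has_real_derivative_iff_has_vector_derivative)

lemma deriv_within_has_real_derivative_at:
  assumes "times_differentiable_on k f {0<..T}" "j < k" "0 < t" "t < T"
  shows "(deriv_within j {0<..T} f has_real_derivative deriv_within (Suc j) {0<..T} f t) (at t)"
proof -
  have "at t within {0<..T} = at t"
    by (rule at_within_nhd[of t "{0<..<T}"]) (use assms in auto)
  then show ?thesis
    using deriv_within_has_real_derivative[OF assms(1,2), of t] assms by simp
qed

text \<open>The derivative of order \<open>k\<close> is bounded by compactness, and the lower ones
  vanish at 0. Each application of the mean value inequality on \<open>{0..t}\<close> lowers the
  order by one and gains a factor \<open>t\<close>.\<close>

lemma modulating_function_power_bound:
  assumes "T > 0" and g: "modulating_function l T g" and "k \<le> l"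
  obtains C where "C \<ge> 0" "\<And>t. t \<in> {0..T} \<Longrightarrow> \<bar>g t\<bar> \<le> C * t ^ k"
proof -
  have td: "times_differentiable_on l g {0..T}"
    and cont_l: "continuous_on {0..T} (deriv_within l {0..T} g)"
    and zero: "\<And>j. j < l \<Longrightarrow> deriv_within j {0..T} g 0 = 0"
    using g by (auto simp: modulating_function_def Ck_on_def)
  have "continuous_on {0..T} (deriv_within k {0..T} g)"
    using td cont_l \<open>k \<le> l\<close> unfolding times_differentiable_on_def
    by (cases "k = l") (auto intro: differentiable_imp_continuous_on)
  then have "bounded (deriv_within k {0..T} g ` {0..T})"
    by (intro compact_imp_bounded compact_continuous_image) auto
  then obtain C where C: "C > 0" "\<And>t. t \<in> {0..T} \<Longrightarrow> \<bar>deriv_within k {0..T} g t\<bar> \<le> C"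
    by (auto simp: bounded_pos)
  have "\<forall>t\<in>{0..T}. \<bar>deriv_within (k - i) {0..T} g t\<bar> \<le> C * t ^ i" if "i \<le> k" for i
    using that
  proof (induction i)
    case 0
    then show ?case using C by simp
  next
    case (Suc i)
    define j where "j = k - Suc i"
    have j: "Suc j = k - i" "j < l" using Suc.prems \<open>k \<le> l\<close> by (auto simp: j_def)
    show ?case
    proof
      fix t assume t: "t \<in> {0..T}"
      have "norm (deriv_within j {0..T} g t - deriv_within j {0..T} g 0) \<le> C * t ^ i * norm (t - 0)"
      proof (rule field_differentiable_bound[of "{0..t}"])
        fix z assume z: "z \<in> {0..t}"
        then show "(deriv_within j {0..T} g has_real_derivative deriv_within (Suc j) {0..T} g z)
            (at z within {0..t})"
          using t by (intro has_field_derivative_subset[OF deriv_within_has_real_derivative[OF td \<open>j < l\<close>]]) auto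
        have "\<bar>deriv_within (Suc j) {0..T} g z\<bar> \<le> C * z ^ i" using Suc z t j(1) by simp
        also have "\<dots> \<le> C * t ^ i" using z C by (intro mult_left_mono power_mono) auto
        finally show "norm (deriv_within (Suc j) {0..T} g z) \<le> C * t ^ i" by simp
      qed (use t in auto)
      then show "\<bar>deriv_within (k - Suc i) {0..T} g t\<bar> \<le> C * t ^ Suc i"
        using zero[OF \<open>j < l\<close>] t by (simp add: j_def mult_ac)
    qed
  qed
  from this[of k] show ?thesis using that[of C] C by auto
qed

section \<open>The fractional integral and its size near zero\<close>

lemma has_integral_abel_kernel:
  assumes "t > 0" "\<delta> > 0"
  shows "((\<lambda>\<tau>. (t - \<tau>) powr (\<delta> - 1)) has_integral t powr \<delta> / \<delta>) {0..t::real}"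
  using has_integral_reflect_scale[OF has_integral_powr_from_0[of "\<delta> - 1" t], of 1] assms by simp

text \<open>This positivity makes the kernel integrable and the Gamma factor positive.\<close>

lemma rl_order_gt:
  assumes "\<gamma> \<ge> 0"
  shows "0 < real (rl_order \<gamma>) - \<gamma>"
proof -
  have "real (nat \<lfloor>\<gamma>\<rfloor>) = of_int \<lfloor>\<gamma>\<rfloor>" using assms by simp
  then show ?thesis unfolding rl_order_def by (simp add: algebra_simps) linarith
qed

lemma rl_order_Suc: "\<gamma> \<ge> 0 \<Longrightarrow> rl_order (\<gamma> + 1) = Suc (rl_order \<gamma>)"
  by (simp add: rl_order_def nat_add_distrib)

text \<open>Raising the order by one leaves the kernel exponent unchanged, so the derivative of
  order \<open>\<gamma> + 1\<close> is one more ordinary derivative of the same function.\<close>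

lemma rl_integral_Suc: "\<gamma> \<ge> 0 \<Longrightarrow> rl_integral (\<gamma> + 1) f = rl_integral \<gamma> f"
  unfolding rl_integral_def[abs_def] rl_order_Suc by simp

text \<open>The integral of the kernel contributes an extra factor
  \<open>t powr \<delta> / \<delta>\<close> with positive \<open>\<delta>\<close>, which tends to
  0.\<close>

lemma rl_integral_small:
  assumes "\<gamma> \<ge> 0" "C \<ge> 0" "T > 0" and g: "\<And>t. t \<in> {0..T} \<Longrightarrow> \<bar>g t\<bar> \<le> C * t ^ k"
  shows "((\<lambda>t. rl_integral \<gamma> g t / t ^ k) \<longlongrightarrow> 0) (at_right 0)"
proof -
  define \<delta> where "\<delta> = real (rl_order \<gamma>) - \<gamma>"
  have "\<delta> > 0" unfolding \<delta>_def by (rule rl_order_gt) fact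
  have bound: "norm (rl_integral \<gamma> g t / t ^ k) \<le> C / \<delta> * t powr \<delta>" if t: "0 < t" "t < T" for t
  proof -
    define f where "f \<tau> = (t - \<tau>) powr (\<delta> - 1) * g \<tau>" for \<tau>
    have F: "rl_integral \<gamma> g t = integral {0..t} f"
      by (simp add: rl_integral_def f_def[abs_def] \<delta>_def)
    have ker: "((\<lambda>\<tau>. C * t ^ k * (t - \<tau>) powr (\<delta> - 1)) has_integral C * t ^ k * (t powr \<delta> / \<delta>)) {0..t}"
      by (intro has_integral_mult_right has_integral_abel_kernel) fact+
    have "norm (integral {0..t} f) \<le> C * t ^ k * (t powr \<delta> / \<delta>)"
    \<comment> \<open>Integrability of \<open>g\<close> is not among the assumptions; without it the
      integral takes its default value 0 and the bound is trivial.\<close>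
    proof (cases "f integrable_on {0..t}")
      case True
      have "norm (integral {0..t} f) \<le> integral {0..t} (\<lambda>\<tau>. C * t ^ k * (t - \<tau>) powr (\<delta> - 1))"
      proof (rule integral_norm_bound_integral[OF True has_integral_integrable[OF ker]])
        fix \<tau> assume \<tau>: "\<tau> \<in> {0..t}"
        then have "\<bar>g \<tau>\<bar> \<le> C * \<tau> ^ k" using g t by simp
        also have "\<dots> \<le> C * t ^ k" using \<tau> \<open>C \<ge> 0\<close> by (intro mult_left_mono power_mono) auto
        finally show "norm (f \<tau>) \<le> C * t ^ k * (t - \<tau>) powr (\<delta> - 1)"
          by (simp add: f_def abs_mult mult.commute[of _ "\<bar>g \<tau>\<bar>"] mult_right_mono)
      qed
      then show ?thesis unfolding integral_unique[OF ker] .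
    qed (use \<open>C \<ge> 0\<close> \<open>\<delta> > 0\<close> t in \<open>simp add: not_integrable_integral\<close>)
    then have "norm (integral {0..t} f) / t ^ k \<le> C * t ^ k * (t powr \<delta> / \<delta>) / t ^ k"
      by (rule divide_right_mono) (use t in simp)
    then show ?thesis using t by (simp add: F)
  qed
  show ?thesis
  proof (rule Lim_null_comparison)
    show "\<forall>\<^sub>F t in at_right 0. norm (rl_integral \<gamma> g t / t ^ k) \<le> C / \<delta> * t powr \<delta>"
      using bound \<open>T > 0\<close> by (auto simp: eventually_at_right_field)
    have "((\<lambda>t::real. t powr \<delta>) \<longlongrightarrow> 0 powr \<delta>) (at_right 0)"
      using \<open>\<delta> > 0\<close>
      by (intro tendsto_powr') (auto simp: eventually_at_right_field intro!: exI[of _ 1])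
    then show "((\<lambda>t. C / \<delta> * t powr \<delta>) \<longlongrightarrow> 0) (at_right 0)"
      by (intro tendsto_mult_right_zero) simp
  qed
qed

section \<open>Integer order\<close>

text \<open>For order \<open>l\<close> the kernel exponent is 0, so the fractional integral is the
  plain antiderivative of \<open>g\<close>. Derivatives relative to \<open>{0<..T}\<close> and to
  \<open>{0..T}\<close> have the same value at positive points.\<close>

lemma deriv_within_rl_integral_nat:
  assumes g: "Ck_on l g {0..T}" and "i \<le> l" and t: "t \<in> {0<..T}"
  shows "deriv_within (Suc i) {0<..T} (rl_integral (real l) g) t = deriv_within i {0..T} g t"
proof -
  have nontrivial: "at t within {0<..T} \<noteq> bot" if "t \<in> {0<..T}" for t
    using that islimpt_greaterThanLessThan2[of 0 t]
    by (auto simp: trivial_limit_within intro: islimpt_subset)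
  have td: "times_differentiable_on l g {0..T}"
    and cont_l: "continuous_on {0..T} (deriv_within l {0..T} g)"
    using g by (auto simp: Ck_on_def)
  have cont: "continuous_on {0..T} g"
  proof (cases l)
    case 0
    then show ?thesis using cont_l by simp
  next
    case (Suc m)
    then have "deriv_within 0 {0..T} g differentiable_on {0..T}"
      using td unfolding times_differentiable_on_def by blast
    then show ?thesis by (auto intro: differentiable_imp_continuous_on)
  qed
  show ?thesis using \<open>i \<le> l\<close> t
  proof (induction i arbitrary: t)
    case 0
    have eq: "rl_integral (real l) g u = integral {0..u} g" for u
      unfolding rl_integral_def
      by (rule integral_spike[of "{u}"]) (auto simp: rl_order_def)
    have "((\<lambda>u. integral {0..u} g) has_vector_derivative g t) (at t within {0<..T})"
      by (rule has_vector_derivative_within_subset[OF integral_has_vector_derivative[OF cont]])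
         (use 0 in auto)
    then show ?case
      using vector_derivative_within[OF nontrivial] 0 by (simp add: eq[abs_def])
  next
    case (Suc i)
    have "(deriv_within i {0..T} g has_real_derivative deriv_within (Suc i) {0..T} g t) (at t within {0..T})"
      by (rule deriv_within_has_real_derivative[OF td]) (use Suc.prems in auto)
    then have "(deriv_within i {0..T} g has_real_derivative deriv_within (Suc i) {0..T} g t) (at t within {0<..T})"
      by (rule has_field_derivative_subset) auto
    then have "(deriv_within i {0..T} g has_vector_derivative deriv_within (Suc i) {0..T} g t) (at t within {0<..T})"
      unfolding has_real_derivative_iff_has_vector_derivative .
    moreover have "deriv_within (Suc i) {0<..T} (rl_integral (real l) g) u = deriv_within i {0..T} g u"
      if "u \<in> {0<..T}" for u
      using that Suc.prems by (intro Suc.IH) auto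
    ultimately have "(deriv_within (Suc i) {0<..T} (rl_integral (real l) g) has_vector_derivative
        deriv_within (Suc i) {0..T} g t) (at t within {0<..T})"
      using has_vector_derivative_transform[OF Suc.prems(2)] by blast
    then show ?case
      unfolding deriv_within.simps(2)[of "Suc i" "{0<..T}"]
      by (rule vector_derivative_within[OF nontrivial[OF Suc.prems(2)]])
  qed
qed

text \<open>By the fundamental theorem the integral is the increment of the derivative of order
  \<open>l - 1\<close>, which vanishes at both ends.\<close>

lemma rl_deriv_nat_integral_zero:
  assumes "T > 0" and g: "modulating_function l T g"
  shows "integral {0..T} (rl_deriv T (real l) g) = 0"
proof -
  have l: "l \<ge> 1" and Ck: "Ck_on l g {0..T}" and td: "times_differentiable_on l g {0..T}"
    and zero: "\<And>j. j < l \<Longrightarrow> deriv_within j {0..T} g 0 = 0 \<and> deriv_within j {0..T} g T = 0"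
    using g by (auto simp: modulating_function_def Ck_on_def)
  have rl: "rl_deriv T (real l) g t = deriv_within l {0..T} g t" if "t \<in> {0<..T}" for t
    using deriv_within_rl_integral_nat[OF Ck order_refl that] that
    by (simp add: rl_deriv_def rl_deriv_pos_def rl_order_def)
  \<comment> \<open>At 0 the fractional derivative is defined as a limit; this single point does not
    affect the integral.\<close>
  have "integral {0..T} (rl_deriv T (real l) g) = integral {0..T} (deriv_within l {0..T} g)"
    by (rule integral_spike[of "{0}"]) (use rl in auto)
  also have "\<dots> = deriv_within (l - 1) {0..T} g T - deriv_within (l - 1) {0..T} g 0"
  proof (intro integral_unique fundamental_theorem_of_calculus)
    fix t assume "t \<in> {0..T}"
    then show "(deriv_within (l - 1) {0..T} g has_vector_derivative deriv_within l {0..T} g t)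
        (at t within {0..T})"
      using deriv_within_has_real_derivative[OF td, of "l - 1" t] l
      by (simp add: has_real_derivative_iff_has_vector_derivative)
  qed (use \<open>T > 0\<close> in simp)
  also have "\<dots> = 0" using zero[of "l - 1"] l by simp
  finally show ?thesis .
qed

section \<open>The noise bound for a single order\<close>

text \<open>Up to the common factor \<open>c\<close>, the derivatives of orders
  \<open>\<gamma>\<close> and \<open>\<gamma> + 1\<close> are the consecutive ordinary derivatives
  \<open>D k\<close> and \<open>D (Suc k)\<close> of one fractional integral. It remains to check
  continuity up to both ends and the alternative at 0 in
  \<open>modulated_noise_bound\<close>.\<close>

lemma rl_deriv_noise_bound:
  assumes "T > 0" "\<omega> > 0" and \<gamma>: "0 \<le> \<gamma>" "\<gamma> \<le> real l" and g: "modulating_function l T g"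
    and ex: "rl_deriv_exists T (\<gamma> + 1) g" and H: "continuous_on {0..T} (rl_deriv T (\<gamma> + 1) g)"
  shows "\<omega> * \<bar>integral {0..T} (\<lambda>t. rl_deriv T \<gamma> g t * sin (\<omega> * (T - t) + \<phi>))\<bar>
           \<le> T * (SUP t\<in>{0..T}. \<bar>rl_deriv T (\<gamma> + 1) g t\<bar>) + \<bar>rl_deriv T \<gamma> g T\<bar>"
proof -
  define k c where "k = rl_order \<gamma>" and "c = 1 / Gamma (real k - \<gamma>)"
  define D where "D j = deriv_within j {0<..T} (rl_integral \<gamma> g)" for j
  define G where "G = rl_deriv T \<gamma> g"
  have "c > 0" unfolding c_def k_def using rl_order_gt[OF \<gamma>(1)] by (simp add: Gamma_real_pos)
  have td: "times_differentiable_on (Suc k) (rl_integral \<gamma> g) {0<..T}"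
    and "\<exists>w. (rl_deriv_pos T (\<gamma> + 1) g \<longlongrightarrow> w) (at_right 0)"
    using ex \<gamma> by (simp_all add: rl_deriv_exists_def rl_order_Suc rl_integral_Suc k_def)
  then obtain w where w: "(rl_deriv_pos T (\<gamma> + 1) g \<longlongrightarrow> w) (at_right 0)" by blast
  have pos: "rl_deriv_pos T \<gamma> g t = c * D k t" "rl_deriv_pos T (\<gamma> + 1) g t = c * D (Suc k) t" for t
    unfolding rl_deriv_pos_def rl_order_Suc[OF \<gamma>(1)] rl_integral_Suc[OF \<gamma>(1)] D_def c_def k_def
    by simp_all
  have G_pos: "G t = c * D k t" and H_pos: "rl_deriv T (\<gamma> + 1) g t = c * D (Suc k) t" if "t > 0" for t
    using that by (simp_all add: rl_deriv_def pos G_def)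
  have dD: "(D j has_real_derivative D (Suc j) t) (at t)" if "j < Suc k" "0 < t" "t < T" for j t
    unfolding D_def by (rule deriv_within_has_real_derivative_at[OF td that])
  have "((\<lambda>t. c * D (Suc k) t / c) \<longlongrightarrow> w / c) (at_right 0)"
    using w \<open>c > 0\<close> unfolding pos by (intro tendsto_intros) auto
  then have "(D (Suc k) \<longlongrightarrow> w / c) (at_right 0)" using \<open>c > 0\<close> by simp
  \<comment> \<open>A limit at 0 is assumed for order \<open>\<gamma> + 1\<close> only. The limit
    for order \<open>\<gamma>\<close> follows from it and gives the \<open>Lim\<close> in
    \<open>G 0\<close> a definite value.\<close>
  from tendsto_at_right_of_derivative_limit[OF \<open>T > 0\<close> dD this] obtain v
    where v: "(D k \<longlongrightarrow> v) (at_right 0)" by blast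
  then have lim_G: "((\<lambda>t. c * D k t) \<longlongrightarrow> c * v) (at_right 0)" by (intro tendsto_intros)
  have "G 0 = Lim (at_right 0) (\<lambda>t. c * D k t)" by (simp add: G_def rl_deriv_def pos[abs_def])
  also have "\<dots> = c * v" by (rule tendsto_Lim[OF trivial_limit_at_right_real lim_G])
  finally have G0: "G 0 = c * v" .
  have cont_G: "continuous_on {0..T} G"
    unfolding continuous_on_def
  proof
    fix t assume t: "t \<in> {0..T}"
    show "(G \<longlongrightarrow> G t) (at t within {0..T})"
    proof (cases "t = 0")
      case True
      have "\<forall>\<^sub>F t in at_right 0. c * D k t = G t"
        using eventually_at_right_less[of "0::real"] by eventually_elim (simp add: G_pos)
      then have "(G \<longlongrightarrow> G 0) (at_right 0)"
        unfolding G0 by (rule Lim_transform_eventually[OF lim_G])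
      then show ?thesis using True \<open>T > 0\<close> by (simp add: at_within_Icc_at_right)
    next
      case False
      have "(D k has_real_derivative D (Suc k) t) (at t within {0<..T})"
        unfolding D_def by (rule deriv_within_has_real_derivative[OF td]) (use t False in auto)
      then have "(D k \<longlongrightarrow> D k t) (at t within {0<..T})"
        using DERIV_continuous continuous_within by blast
      then have "((\<lambda>t. c * D k t) \<longlongrightarrow> c * D k t) (at t within {0<..T})"
        by (intro tendsto_intros)
      moreover have "\<forall>\<^sub>F u in at t within {0<..T}. c * D k u = G u"
        by (auto simp: eventually_at_filter G_pos intro!: always_eventually)
      ultimately have "(G \<longlongrightarrow> c * D k t) (at t within {0<..T})"
        by (rule Lim_transform_eventually)
      moreover have "at t within {0<..T} = at t within {0..T}"
        by (rule at_within_nhd[of t "{0<..}"]) (use t False in auto)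
      ultimately show ?thesis using G_pos t False by simp
    qed
  qed
  have dG: "(G has_real_derivative rl_deriv T (\<gamma> + 1) g t) (at t)" if t: "0 < t" "t < T" for t
  proof -
    have "((\<lambda>t. c * D k t) has_real_derivative c * D (Suc k) t) (at t)"
      by (intro DERIV_cmult dD) (use t in auto)
    then have "(G has_real_derivative c * D (Suc k) t) (at t)"
      by (rule has_field_derivative_transform_within_open[of _ _ _ "{0<..}"])
         (use t in \<open>auto simp: G_pos\<close>)
    then show ?thesis using H_pos t by simp
  qed
  have bound: "\<bar>rl_deriv T (\<gamma> + 1) g t\<bar> \<le> (SUP t\<in>{0..T}. \<bar>rl_deriv T (\<gamma> + 1) g t\<bar>)"
    if "t \<in> {0..T}" for t
  proof (rule cSUP_upper[OF that])
    show "bdd_above ((\<lambda>t. \<bar>rl_deriv T (\<gamma> + 1) g t\<bar>) ` {0..T})"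
      by (intro bounded_imp_bdd_above compact_imp_bounded compact_continuous_image
          continuous_intros H) auto
  qed
  text \<open>If \<open>\<gamma> = l\<close>, then \<open>G 0\<close> is the \<open>l\<close>-th derivative of \<open>g\<close> at \<open>0\<close>, which need not vanish.\<close>
  have zero: "G 0 = 0 \<or> integral {0..T} G = 0"
  proof (cases "\<gamma> = real l")
    case True
    then show ?thesis using rl_deriv_nat_integral_zero[OF \<open>T > 0\<close> g] by (simp add: G_def)
  next
    case False
    \<comment> \<open>A real \<open>\<gamma>\<close> below the integer \<open>l\<close> has
      \<open>\<lfloor>\<gamma>\<rfloor> + 1 \<le> l\<close>, so \<open>g\<close> vanishes at 0 to
      the order \<open>k\<close> needed; for \<open>\<gamma> = l\<close> the order \<open>k\<close>
      would be \<open>l + 1\<close>.\<close>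
    then have "k \<le> l" using \<gamma> unfolding k_def rl_order_def by linarith
    then obtain C where "C \<ge> 0" "\<And>t. t \<in> {0..T} \<Longrightarrow> \<bar>g t\<bar> \<le> C * t ^ k"
      using modulating_function_power_bound[OF \<open>T > 0\<close> g] by blast
    then have "((\<lambda>t. rl_integral \<gamma> g t / t ^ k) \<longlongrightarrow> 0) (at_right 0)"
      by (intro rl_integral_small[OF \<gamma>(1) _ \<open>T > 0\<close>])
    then have "v = 0"
      by (intro derivative_limit_zero[where f = D and k = k, OF \<open>T > 0\<close> _ v])
         (auto intro: dD simp: D_def[of 0])
    then show ?thesis by (simp add: G0)
  qed
  show ?thesis
    unfolding G_def[symmetric]
    by (rule modulated_noise_bound[where H = "rl_deriv T (\<gamma> + 1) g",
          OF \<open>T > 0\<close> \<open>\<omega> > 0\<close> cont_G H dG bound zero])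
qed

theorem proposition3:
  fixes T c \<omega> \<phi> :: real
    and L M N l :: nat
    and \<alpha> \<beta> :: "nat \<Rightarrow> real"
    and g :: "nat \<Rightarrow> real \<Rightarrow> real"
    and noise :: "real \<Rightarrow> real"
    and e :: "nat \<Rightarrow> nat \<Rightarrow> real"
  assumes "T > 0"
    and "0 \<le> \<alpha> 0" and "strict_mono_on {0..L} \<alpha>"
    and "0 \<le> \<beta> 0" and "strict_mono_on {0..M} \<beta>"
    and "int l = \<lceil>max (\<alpha> L) (\<beta> M)\<rceil>" and "l \<ge> 1"
    and "N \<ge> L + M + 1"
    and "\<forall>n\<in>{1..N}. modulating_function l T (g n)"
    and "c > 0" and "\<omega> > 0" and "0 \<le> \<phi>" and "\<phi> < 2 * pi"
    and "\<forall>t\<in>{0..T}. noise t = c * sin (\<omega> * t + \<phi>)"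
    and "\<forall>n\<in>{1..N}. \<forall>i\<in>{0..L}.
           rl_deriv_exists T (\<alpha> i + 1) (g n) \<and>
           continuous_on {0..T} (rl_deriv T (\<alpha> i + 1) (g n))"
    and "\<forall>n\<in>{1..N}. \<forall>i\<in>{0..L}. e n (i + 1) = noise_error T (\<alpha> i) (g n) noise"
  shows "\<forall>n\<in>{1..N}. \<forall>i\<in>{0..L}.
           \<bar>e n (i + 1)\<bar> \<le>
             c / \<omega> * T * (SUP t\<in>{0..T}. \<bar>rl_deriv T (\<alpha> i + 1) (g n) t\<bar>)
             + c / \<omega> * \<bar>rl_deriv T (\<alpha> i) (g n) T\<bar>"
proof (intro ballI)
  fix n i assume n: "n \<in> {1..N}" and i: "i \<in> {0..L}"
  have mono: "\<alpha> a \<le> \<alpha> b" if "a \<le> b" "b \<le> L" for a b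
    using strict_mono_on_leD[OF assms(3), of a b] that by auto
  have "0 \<le> \<alpha> i" using mono[of 0 i] i \<open>0 \<le> \<alpha> 0\<close> by simp
  moreover have "\<alpha> i \<le> real l"
  proof -
    have "\<alpha> i \<le> max (\<alpha> L) (\<beta> M)" using mono[of i L] i by simp
    also have "\<dots> \<le> of_int \<lceil>max (\<alpha> L) (\<beta> M)\<rceil>" by (rule le_of_int_ceiling)
    also have "\<dots> = real l" using assms(6) by (metis of_int_of_nat_eq)
    finally show ?thesis .
  qed
  ultimately have bound: "\<omega> * \<bar>integral {0..T} (\<lambda>t. rl_deriv T (\<alpha> i) (g n) t * sin (\<omega> * (T - t) + \<phi>))\<bar>
      \<le> T * (SUP t\<in>{0..T}. \<bar>rl_deriv T (\<alpha> i + 1) (g n) t\<bar>) + \<bar>rl_deriv T (\<alpha> i) (g n) T\<bar>"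
    (is "\<omega> * \<bar>?I\<bar> \<le> ?R")
    by (rule rl_deriv_noise_bound[OF \<open>T > 0\<close> \<open>\<omega> > 0\<close>]) (use assms n i in auto)
  \<comment> \<open>For t in \<open>{0..T}\<close> the reversed time \<open>T - t\<close> lies there
    too, so the formula for the noise applies under the integral.\<close>
  have "e n (i + 1) = integral {0..T} (\<lambda>t. c * (rl_deriv T (\<alpha> i) (g n) t * sin (\<omega> * (T - t) + \<phi>)))"
    unfolding assms(16)[rule_format, OF n i] noise_error_def
    by (intro integral_cong) (simp add: assms(14))
  then have "\<bar>e n (i + 1)\<bar> = c * \<bar>?I\<bar>" using \<open>c > 0\<close> by (simp add: abs_mult)
  also have "\<dots> \<le> c * (?R / \<omega>)"
    using bound \<open>c > 0\<close> \<open>\<omega> > 0\<close> by (intro mult_left_mono) (simp_all add: pos_le_divide_eq mult.commute)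
  also have "\<dots> = c / \<omega> * T * (SUP t\<in>{0..T}. \<bar>rl_deriv T (\<alpha> i + 1) (g n) t\<bar>)
      + c / \<omega> * \<bar>rl_deriv T (\<alpha> i) (g n) T\<bar>"
    by (simp add: add_divide_distrib distrib_left)
  finally show "\<bar>e n (i + 1)\<bar> \<le> c / \<omega> * T * (SUP t\<in>{0..T}. \<bar>rl_deriv T (\<alpha> i + 1) (g n) t\<bar>)
      + c / \<omega> * \<bar>rl_deriv T (\<alpha> i) (g n) T\<bar>" .
qed

end
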